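(* Let $X\subset Y\subset Z$ be Banach spaces with continuous embeddings, let $F\in C^1(X\times\mathbb{R},Z)$ satisfy $F(0,0)=0$, and let $U\subset X\times\mathbb{R}$ be an open neighborhood of $(0,0)$. Assume that for each $(x,s)\in U$ the partial Fréchet derivative $\partial_xF(x,s)\in\mathcal{L}(X,Z)$ has an extension to an operator in $\mathcal{L}(Y,Z)$, again denoted by $\partial_xF(x,s)$, such that $\partial_xF(\cdot,\cdot)\in C(U,\mathcal{L}(Y,Z))$ and such that the extended operator is invertible with $\partial_xF(x,s)^{-1}\in\mathcal{L}(Z,Y)$ for all $(x,s)\in U$. Let $\varepsilon>0$ and let $x(\cdot)\in C([0,\varepsilon),X)\cap C^1([0,\varepsilon),Y)$ satisfy $(x(s),s)\in U$ for all $0\le s<\varepsilon$. Then $$F(x(s),s)=0\ \text{ for all }0\le s<\varepsilon\quad\text{and}\quad x(0)=0$$ if and only if $x$ solves $$x'(s)+\partial_xF(x(s),s)^{-1}\partial_sF(x(s),s)=0\quad(0\le s<\varepsilon),\qquad x(0)=0.$$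
   Context: $\mathcal{L}(E_1,E_2)$ denotes the space of bounded linear operators from the Banach space $E_1$ to the Banach space $E_2$ with the operator norm. *)

theory Defs
  imports "HOL-Analysis.Analysis"
begin

text \<open>An inclusion of Banach spaces with continuous embedding is represented by the inclusion map,
  an injective bounded linear map between types.\<close>

definition continuous_embedding :: "('a::real_normed_vector \<Rightarrow> 'b::real_normed_vector) \<Rightarrow> bool"
  where "continuous_embedding i \<longleftrightarrow> bounded_linear i \<and> inj i"

text \<open>The derivative is continuous for the operator norm. It is taken within \<open>S\<close>, so that it is
  the usual one for open \<open>S\<close> and one-sided at an endpoint belonging to an interval \<open>S\<close>; in both
  cases it is unique.\<close>

definition C1_on :: "'a::real_normed_vector set \<Rightarrow> ('a \<Rightarrow> 'b::real_normed_vector) \<Rightarrow> bool"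
  where "C1_on S f \<longleftrightarrow>
    (\<exists>f' :: 'a \<Rightarrow> 'a \<Rightarrow>\<^sub>L 'b.
      (\<forall>a\<in>S. (f has_derivative blinfun_apply (f' a)) (at a within S)) \<and> continuous_on S f')"

definition partial_x ::
  "('a::real_normed_vector \<times> real \<Rightarrow> 'c::real_normed_vector) \<Rightarrow> 'a \<times> real \<Rightarrow> 'a \<Rightarrow> 'c"
  where "partial_x F p = frechet_derivative (\<lambda>x. F (x, snd p)) (at (fst p))"

definition partial_s ::
  "('a::real_normed_vector \<times> real \<Rightarrow> 'c::real_normed_vector) \<Rightarrow> 'a \<times> real \<Rightarrow> 'c"
  where "partial_s F p = vector_derivative (\<lambda>s. F (fst p, s)) (at (snd p))"

end

theory Submission
  imports Defs
begin

text \<open>Only \<open>i \<circ> x\<close> is differentiable, so the ordinary chain rule does not apply to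
  \<open>s \<mapsto> F (x s, s)\<close>. It is replaced as follows: integrating the extended partial derivative along
  segments of \<open>X\<close>, the error of linearising \<open>F (\<cdot>, t)\<close> is controlled by the norm of \<open>Y\<close>, in
  which \<open>x\<close> is Lipschitz at \<open>s\<close>. Hence \<open>s \<mapsto> F (x s, s)\<close> has derivative
  \<open>\<partial>\<^sub>x F (i x)' + \<partial>\<^sub>s F\<close>. Since \<open>F (x 0, 0) = 0\<close>, the function is identically zero iff its
  derivative is, which is the differential equation because \<open>\<partial>\<^sub>x F\<close> is injective on \<open>Y\<close>.\<close>

lemma partial_linearization_bound:
  fixes F :: "'x::real_normed_vector \<times> real \<Rightarrow> 'z::real_normed_vector"
    and D :: "'x \<times> real \<Rightarrow> 'y::real_normed_vector \<Rightarrow>\<^sub>L 'z"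
  assumes i: "bounded_linear i"
    and U: "open U" "(a, s) \<in> U" and D: "continuous_on U D"
    and deriv: "\<And>p. p \<in> U \<Longrightarrow> ((\<lambda>x. F (x, snd p)) has_derivative (\<lambda>h. D p (i h))) (at (fst p))"
    and "\<eta> > 0"
  obtains \<delta> where "\<delta> > 0"
    and "\<And>b t. dist b a < \<delta> \<Longrightarrow> dist t s < \<delta> \<Longrightarrow>
      norm (F (b, t) - F (a, t) - D (a, s) (i (b - a))) \<le> \<eta> * norm (i (b - a))"
proof -
  interpret i: bounded_linear i by fact
  have "isCont D (a, s)"
    using D U by (simp add: continuous_on_eq_continuous_at)
  then obtain d1 where d1: "d1 > 0" "\<And>p. dist p (a, s) < d1 \<Longrightarrow> dist (D p) (D (a, s)) < \<eta>"
    using \<open>\<eta> > 0\<close> unfolding continuous_at_eps_delta by metis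
  obtain d2 where d2: "d2 > 0" "\<And>p. dist p (a, s) < d2 \<Longrightarrow> p \<in> U"
    using U unfolding open_dist by metis
  \<comment> \<open>The product distance is at most the sum of the two component distances, so
    halving keeps the whole segment inside both balls.\<close>
  define \<delta> where "\<delta> = min d1 d2 / 2"
  show thesis
  proof
    show "\<delta> > 0" using d1 d2 by (simp add: \<delta>_def)
    fix b t assume b: "dist b a < \<delta>" and t: "dist t s < \<delta>"
    have near: "dist (a + r *\<^sub>R (b - a), t) (a, s) < min d1 d2" if "r \<in> {0..1}" for r :: real
    proof -
      have "dist (a + r *\<^sub>R (b - a), t) (a, s) \<le> dist (a + r *\<^sub>R (b - a)) a + dist t s"
        unfolding dist_Pair_Pair by (rule order_trans[OF sqrt_sum_squares_le_sum_abs]) simp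
      also have "dist (a + r *\<^sub>R (b - a)) a \<le> 1 * dist b a"
        using that by (simp add: dist_norm mult_left_le_one_le)
      finally show ?thesis using b t by (simp add: \<delta>_def)
    qed
    \<comment> \<open>The increment \<open>\<phi> 1 - \<phi> 0\<close> is exactly the linearisation
      error.\<close>
    define \<phi> where "\<phi> r = F (a + r *\<^sub>R (b - a), t) - D (a, s) (i (r *\<^sub>R (b - a)))" for r
    have "norm (\<phi> 1 - \<phi> 0) \<le> \<eta> * norm (i (b - a)) * norm (1 - 0 :: real)"
    proof (rule differentiable_bound)
      fix r :: real assume r: "r \<in> {0..1}"
      let ?p = "(a + r *\<^sub>R (b - a), t)"
      let ?v = "(D ?p - D (a, s)) (i (b - a))"
      have "((\<lambda>x. F (x, t)) has_derivative (\<lambda>h. D ?p (i h))) (at (a + r *\<^sub>R (b - a)))"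
        using deriv[of ?p] d2(2)[of ?p] near[OF r] by simp
      then have "((\<lambda>r. F (a + r *\<^sub>R (b - a), t)) has_derivative
          (\<lambda>h. D ?p (i (h *\<^sub>R (b - a))))) (at r within {0..1})"
        by (rule has_derivative_compose[rotated]) (auto intro!: derivative_eq_intros)
      moreover have "((\<lambda>r. D (a, s) (i (r *\<^sub>R (b - a)))) has_derivative
          (\<lambda>h. D (a, s) (i (h *\<^sub>R (b - a))))) (at r within {0..1})"
        by (intro bounded_linear_imp_has_derivative
            bounded_linear_compose[OF blinfun.bounded_linear_right]
            bounded_linear_compose[OF i] bounded_linear_scaleR_left)
      ultimately show "(\<phi> has_derivative (\<lambda>h. h *\<^sub>R ?v)) (at r within {0..1})"
        unfolding \<phi>_def
        by (rule has_derivative_eq_rhs[OF has_derivative_diff])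
          (simp add: fun_eq_iff i.scaleR i.diff blinfun.scaleR_right blinfun.diff_left blinfun.diff_right
            scaleR_diff_right)
      have "norm ?v \<le> norm (D ?p - D (a, s)) * norm (i (b - a))"
        by (rule norm_blinfun)
      also have "\<dots> \<le> \<eta> * norm (i (b - a))"
        using d1(2)[of ?p] near[OF r] by (intro mult_right_mono) (auto simp: dist_norm)
      finally show "onorm (\<lambda>h. h *\<^sub>R ?v) \<le> \<eta> * norm (i (b - a))"
        by (intro onorm_le) (simp add: mult.commute mult_left_mono)
    qed auto
    then show "norm (F (b, t) - F (a, t) - D (a, s) (i (b - a))) \<le> \<eta> * norm (i (b - a))"
      by (simp add: \<phi>_def i.zero algebra_simps)
  qed
qed

text \<open>Continuity of \<open>x\<close> in \<open>X\<close> only brings \<open>x t\<close> into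
  the range of the linearisation bound; the rate comes from \<open>i (x t - x s)\<close> being of
  order \<open>t - s\<close>. The other contributions are a fixed bounded operator applied to
  \<open>i (x t)\<close> and \<open>F\<close> with its first argument frozen at
  \<open>x s\<close>.\<close>

lemma has_vector_derivative_along_weak_curve:
  fixes F :: "'x::real_normed_vector \<times> real \<Rightarrow> 'z::real_normed_vector"
    and D :: "'x \<times> real \<Rightarrow> 'y::real_normed_vector \<Rightarrow>\<^sub>L 'z"
  assumes i: "bounded_linear i"
    and U: "open U" "(x s, s) \<in> U" and D: "continuous_on U D"
    and deriv: "\<And>p. p \<in> U \<Longrightarrow> ((\<lambda>x. F (x, snd p)) has_derivative (\<lambda>h. D p (i h))) (at (fst p))"
    and deriv_s: "((\<lambda>t. F (x s, t)) has_vector_derivative c) (at s within S)"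
    and x: "continuous (at s within S) x"
    and y: "((\<lambda>t. i (x t)) has_vector_derivative y') (at s within S)"
  shows "((\<lambda>t. F (x t, t)) has_vector_derivative (D (x s, s) y' + c)) (at s within S)"
proof -
  interpret i: bounded_linear i by fact
  define R where "R t = F (x t, t) - F (x s, t) - D (x s, s) (i (x t - x s))" for t
  have "(R has_derivative (\<lambda>h. 0)) (at s within S)"
    unfolding has_derivative_within_alt
  proof (intro conjI allI impI)
    fix e :: real assume "e > 0"
    \<comment> \<open>A Lipschitz constant of \<open>i (x t)\<close> at \<open>s\<close>: the
      derivative plus an error taken with tolerance 1. It is positive even if \<open>y' = 0\<close>,
      so \<open>e / K\<close> is a legitimate tolerance.\<close>
    define K where "K = norm y' + 1"
    have K: "K > 0" by (simp add: K_def add_nonneg_pos)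
    then have "e / K > 0" using \<open>e > 0\<close> by simp
    from partial_linearization_bound[OF i U D deriv this]
    obtain d where d: "d > 0" "\<And>b t. dist b (x s) < d \<Longrightarrow> dist t s < d \<Longrightarrow>
        norm (F (b, t) - F (x s, t) - D (x s, s) (i (b - x s))) \<le> e / K * norm (i (b - x s))"
      by metis
    obtain d1 where d1: "d1 > 0" "\<And>t. t \<in> S \<Longrightarrow> dist t s < d1 \<Longrightarrow> dist (x t) (x s) < d"
      using x d(1) unfolding continuous_within_eps_delta by metis
    obtain d2 where d2: "d2 > 0" "\<And>t. t \<in> S \<Longrightarrow> norm (t - s) < d2 \<Longrightarrow>
        norm (i (x t) - i (x s) - (t - s) *\<^sub>R y') \<le> 1 * norm (t - s)"
      using y unfolding has_vector_derivative_def has_derivative_within_alt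
      by (meson zero_less_one)
    have "norm (R t - R s - 0) \<le> e * norm (t - s)"
      if t: "t \<in> S" "norm (t - s) < min d (min d1 d2)" for t
    proof -
      have "norm (i (x t - x s)) = norm ((i (x t) - i (x s) - (t - s) *\<^sub>R y') + (t - s) *\<^sub>R y')"
        by (simp add: i.diff)
      also have "\<dots> \<le> norm (t - s) + norm ((t - s) *\<^sub>R y')"
        using d2(2)[of t] t by (intro norm_triangle_mono) auto
      also have "\<dots> = K * norm (t - s)"
        by (simp add: K_def distrib_right)
      finally have "e / K * norm (i (x t - x s)) \<le> e / K * (K * norm (t - s))"
        using \<open>e / K > 0\<close> by (intro mult_left_mono) auto
      moreover have "norm (R t) \<le> e / K * norm (i (x t - x s))"
        unfolding R_def using d(2)[of "x t" t] d1(2)[of t] t by (simp add: dist_norm)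
      moreover have "R s = 0"
        by (simp add: R_def i.zero)
      ultimately show ?thesis using K by simp
    qed
    then show "\<exists>d>0. \<forall>t\<in>S. norm (t - s) < d \<longrightarrow> norm (R t - R s - 0) \<le> e * norm (t - s)"
      using d(1) d1(1) d2(1) by (intro exI[of _ "min d (min d1 d2)"]) auto
  qed simp
  then have "(R has_vector_derivative 0) (at s within S)"
    by (simp add: has_vector_derivative_def)
  moreover have "((\<lambda>t. D (x s, s) (i (x t))) has_vector_derivative D (x s, s) y') (at s within S)"
    by (rule bounded_linear.has_vector_derivative[OF blinfun.bounded_linear_right y])
  \<comment> \<open>The three summands recombine to \<open>F (x t, t)\<close>, and each is
    differentiable at \<open>s\<close>.\<close>
  ultimately have "((\<lambda>t. R t + (D (x s, s) (i (x t)) - D (x s, s) (i (x s))) + F (x s, t))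
      has_vector_derivative (0 + (D (x s, s) y' - 0) + c)) (at s within S)"
    by (intro has_vector_derivative_add has_vector_derivative_diff has_vector_derivative_const
        deriv_s)
  moreover have "R t + (D (x s, s) (i (x t)) - D (x s, s) (i (x s))) + F (x s, t) = F (x t, t)" for t
    by (simp add: R_def i.diff blinfun.diff_right)
  ultimately show ?thesis by simp
qed

theorem proposition2p1:
  fixes iXY :: "'x::banach \<Rightarrow> 'y::banach" and iYZ :: "'y \<Rightarrow> 'z::banach"
    and F :: "'x \<times> real \<Rightarrow> 'z"
    and U :: "('x \<times> real) set"
    and dF :: "'x \<times> real \<Rightarrow> 'y \<Rightarrow>\<^sub>L 'z"
    and \<epsilon> :: real
    and x :: "real \<Rightarrow> 'x"
  assumes "continuous_embedding iXY" and "continuous_embedding iYZ"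
    and "C1_on UNIV F" and "F (0, 0) = 0"
    and "open U" and "(0, 0) \<in> U"
    and "\<And>p h. p \<in> U \<Longrightarrow> blinfun_apply (dF p) (iXY h) = partial_x F p h"
    and "continuous_on U dF"
    and "\<And>p. p \<in> U \<Longrightarrow> bij (blinfun_apply (dF p)) \<and> bounded_linear (inv (blinfun_apply (dF p)))"
    and "\<epsilon> > 0"
    and "continuous_on {0..<\<epsilon>} x" and "C1_on {0..<\<epsilon>} (\<lambda>s. iXY (x s))"
    and "\<And>s. 0 \<le> s \<Longrightarrow> s < \<epsilon> \<Longrightarrow> (x s, s) \<in> U"
  shows "((\<forall>s\<in>{0..<\<epsilon>}. F (x s, s) = 0) \<and> x 0 = 0) \<longleftrightarrow>
    ((\<forall>s\<in>{0..<\<epsilon>}.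
        vector_derivative (\<lambda>t. iXY (x t)) (at s within {0..<\<epsilon>})
          + inv (blinfun_apply (dF (x s, s))) (partial_s F (x s, s)) = 0)
      \<and> x 0 = 0)"
proof -
  let ?S = "{0..<\<epsilon>}"
  define y' where "y' s = vector_derivative (\<lambda>t. iXY (x t)) (at s within ?S)" for s
  define G where "G s = dF (x s, s) (y' s) + partial_s F (x s, s)" for s
  have F_diff: "F differentiable (at p)" for p
    using assms(3) unfolding C1_on_def differentiable_def by blast
  have Fx: "((\<lambda>x. F (x, snd p)) has_derivative (\<lambda>h. dF p (iXY h))) (at (fst p))" if "p \<in> U" for p
  proof -
    have "(\<lambda>x. F (x, snd p)) differentiable (at (fst p))"
      using F_diff[of p]
      by (intro differentiable_compose[of F "\<lambda>x. (x, snd p)"])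
        (auto simp: differentiable_def intro!: exI derivative_eq_intros)
    then show ?thesis
      using assms(7)[OF that] by (simp add: frechet_derivative_works partial_x_def)
  qed
  have Fs: "((\<lambda>s. F (fst p, s)) has_vector_derivative partial_s F p) (at (snd p))" for p
  proof -
    have "(\<lambda>s. F (fst p, s)) differentiable (at (snd p))"
      using F_diff[of p]
      by (intro differentiable_compose[of F "\<lambda>s. (fst p, s)"])
        (auto simp: differentiable_def intro!: exI derivative_eq_intros)
    then show ?thesis
      by (simp add: vector_derivative_works partial_s_def)
  qed
  have deriv: "((\<lambda>t. F (x t, t)) has_vector_derivative G s) (at s within ?S)" if "s \<in> ?S" for s
    unfolding G_def
  proof (rule has_vector_derivative_along_weak_curve[OF _ assms(5) _ assms(8) Fx])
    show "bounded_linear iXY"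
      using assms(1) by (simp add: continuous_embedding_def)
    show "(x s, s) \<in> U" using assms(13) that by simp
    show "((\<lambda>t. F (x s, t)) has_vector_derivative partial_s F (x s, s)) (at s within ?S)"
      using Fs[of "(x s, s)"] by (simp add: has_vector_derivative_at_within)
    show "continuous (at s within ?S) x"
      using assms(11) that by (simp add: continuous_on_eq_continuous_within)
    show "((\<lambda>t. iXY (x t)) has_vector_derivative y' s) (at s within ?S)"
      unfolding y'_def vector_derivative_works[symmetric]
      using assms(12) that unfolding C1_on_def differentiable_def by blast
  qed auto
  have G_iff: "G s = 0 \<longleftrightarrow> y' s + inv (dF (x s, s)) (partial_s F (x s, s)) = 0" if "s \<in> ?S" for s
  proof -
    let ?D = "dF (x s, s)"
    have bij: "bij (blinfun_apply ?D)" using assms(9,13) that by simp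
    \<comment> \<open>Surjectivity lets \<open>?D\<close> be factored out of \<open>G s\<close>;
      injectivity then cancels it.\<close>
    then have "G s = ?D (y' s + inv ?D (partial_s F (x s, s)))"
      by (simp add: G_def blinfun.add_right bij_is_surj surj_f_inv_f)
    then show ?thesis
      using bij_is_inj[OF bij] by (metis blinfun.zero_right injD)
  qed
  have "(\<forall>s\<in>?S. F (x s, s) = 0) \<longleftrightarrow> (\<forall>s\<in>?S. G s = 0)" if "x 0 = 0"
  proof
    assume zero: "\<forall>s\<in>?S. F (x s, s) = 0"
    show "\<forall>s\<in>?S. G s = 0"
    proof
      fix s assume s: "s \<in> ?S"
      have "((\<lambda>t. F (x t, t)) has_vector_derivative 0) (at s within ?S)"
        using zero by (intro has_vector_derivative_transform[OF s _ has_vector_derivative_const]) auto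
      \<comment> \<open>Derivatives within \<open>?S\<close> are unique because each of its points,
        including the endpoint 0, is a limit point.\<close>
      moreover have "at s within ?S \<noteq> bot"
        using s by (simp add: trivial_limit_within islimpt_Ico)
      ultimately show "G s = 0"
        using vector_derivative_unique_within deriv[OF s] by metis
    qed
  next
    assume "\<forall>s\<in>?S. G s = 0"
    then have "\<And>s. s \<in> ?S \<Longrightarrow> ((\<lambda>t. F (x t, t)) has_vector_derivative 0) (at s within ?S)"
      using deriv by metis
    \<comment> \<open>The interval is convex, so a zero derivative forces a constant; its value is
      read off at \<open>s = 0\<close>, where \<open>x 0 = 0\<close> and
      \<open>F (0, 0) = 0\<close>.\<close>
    then obtain c where "\<And>s. s \<in> ?S \<Longrightarrow> F (x s, s) = c"
      using has_vector_derivative_zero_constant[of ?S "\<lambda>t. F (x t, t)"] by auto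
    moreover from this[of 0] have "c = 0"
      using that assms(4,10) by simp
    ultimately show "\<forall>s\<in>?S. F (x s, s) = 0" by simp
  qed
  then show ?thesis
    using G_iff unfolding y'_def by auto
qed

end
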